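(* Let $\mathcal X$ be a $C^r$ vector field, $r\ge 2$, near the origin of $\mathbb R^2$, with $\mathcal X(0)=0$ and $A:=D\mathcal X(0)$ satisfying $A\ne0$, $A^2=0$. Let $(q_0,q_1)$ and $(\widetilde q_0,\widetilde q_1)$ be two Jordan chains of $A$ related by $$\widetilde q_0=a q_0,\qquad \widetilde q_1=a q_1+b q_0,\qquad a\in\mathbb R\setminus\{0\},\ b\in\mathbb R,$$ and let $\mathcal R_{\mathcal X}$ and $\widetilde{\mathcal R}_{\mathcal X}$ be the distinguished eigendirection restrictions of $\mathcal X$ associated with $(q_0,q_1)$ and $(\widetilde q_0,\widetilde q_1)$, respectively. Then, for $\widetilde u$ near $0$, $$\widetilde{\mathcal R}_{\mathcal X}(\widetilde u)=\frac1a\,\mathcal R_{\mathcal X}(a\widetilde u).$$ In particular, the transformation law is independent of the parameter $b$.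
   Context: A Jordan chain of $A$ is a pair $(q_0,q_1)$ of vectors in $\mathbb R^2$ with $q_0\neq0$, $Aq_0=0$, $Aq_1=q_0$. Let $K=\ker A=\operatorname{im}A$ (one-dimensional). The map $\rho_{\mathcal X}(\xi)=A\mathcal X(\xi)$, $\xi\in K$ near the origin, takes values in $K$. The distinguished eigendirection restriction associated with a Jordan chain $(q_0,q_1)$ is the unique scalar function $\mathcal R_{\mathcal X}$ near $0$ with $A\mathcal X(uq_0)=\mathcal R_{\mathcal X}(u)\,q_0$. *)

theory Defs
  imports "HOL-Analysis.Analysis" "HOL-Library.Extended_Nat"
begin

text \<open>
  Differentiability of finite order, by recursion on the order: all directional derivatives
  of a differentiable map have to be one order smoother. In finite dimension this is the usual
  notion of a map of class \<open>C\<^sup>k\<close> on an open set.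
\<close>

fun Ck_on :: "nat \<Rightarrow> ('a::euclidean_space \<Rightarrow> 'b::real_normed_vector) \<Rightarrow> 'a set \<Rightarrow> bool" where
  "Ck_on 0 f U \<longleftrightarrow> continuous_on U f"
| "Ck_on (Suc k) f U \<longleftrightarrow>
     (\<forall>x\<in>U. f differentiable (at x)) \<and>
     (\<forall>v. Ck_on k (\<lambda>x. frechet_derivative f (at x) v) U)"

text \<open>The order \<open>r\<close> may be \<open>\<infinity>\<close>. A vector field near the origin is represented
  by a total function whose values away from the origin are irrelevant.\<close>

definition Cr_near_0 :: "enat \<Rightarrow> ('a::euclidean_space \<Rightarrow> 'b::real_normed_vector) \<Rightarrow> bool" where
  "Cr_near_0 r f \<longleftrightarrow>
     (\<exists>U. open U \<and> 0 \<in> U \<and> (\<forall>k::nat. enat k \<le> r \<longrightarrow> Ck_on k f U))"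

definition jordan_chain :: "real^2^2 \<Rightarrow> real^2 \<Rightarrow> real^2 \<Rightarrow> bool" where
  "jordan_chain A q0 q1 \<longleftrightarrow> q0 \<noteq> 0 \<and> A *v q0 = 0 \<and> A *v q1 = q0"

text \<open>
  \<open>R\<close> is a representative of the distinguished eigendirection restriction of \<open>X\<close> associated with
  the Jordan chain \<open>(q0, q1)\<close> of \<open>DX(0)\<close>. The restriction is a function near \<open>0\<close> only, so it is
  determined up to equality in a neighbourhood of \<open>0\<close>; existence and uniqueness in this sense are
  shown below.
\<close>

definition eigendirection_restriction ::
    "(real^2 \<Rightarrow> real^2) \<Rightarrow> real^2 \<Rightarrow> real^2 \<Rightarrow> (real \<Rightarrow> real) \<Rightarrow> bool" where
  "eigendirection_restriction X q0 q1 R \<longleftrightarrow>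
     jordan_chain (jacobian X (at 0)) q0 q1 \<and>
     (\<forall>\<^sub>F u in nhds 0. jacobian X (at 0) *v X (u *\<^sub>R q0) = R u *\<^sub>R q0)"

lemma jordan_chain_range:
  assumes "jordan_chain A q0 q1"
  shows "\<exists>c. A *v x = c *\<^sub>R q0"
proof -
  have q: "q0 \<noteq> 0" "A *v q0 = 0" "A *v q1 = q0"
    using assms by (auto simp: jordan_chain_def)
  have nin: "q1 \<notin> span {q0}"
  proof
    assume "q1 \<in> span {q0}"
    then obtain k where "q1 = k *\<^sub>R q0"
      by (auto simp: span_singleton)
    then have "A *v q1 = k *\<^sub>R (A *v q0)"
      by (simp add: matrix_vector_mult_scaleR)
    then show False using q by simp
  qed
  then have ind: "independent {q1, q0}" and ne: "q1 \<noteq> q0"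
    using q(1) by (auto simp: independent_insert span_base)
  have "UNIV \<subseteq> span {q1, q0}"
    by (rule card_ge_dim_independent) (use ind ne in \<open>auto simp: dim_UNIV\<close>)
  then have "x \<in> span {q1, q0}"
    by blast
  then obtain k where "x - k *\<^sub>R q1 \<in> span {q0}"
    by (auto simp: span_insert)
  then obtain l where "x - k *\<^sub>R q1 = l *\<^sub>R q0"
    by (auto simp: span_singleton)
  then have "x = k *\<^sub>R q1 + l *\<^sub>R q0"
    by (simp add: algebra_simps)
  then have "A *v x = k *\<^sub>R q0"
    using q by (simp add: matrix_vector_right_distrib matrix_vector_mult_scaleR)
  then show ?thesis by blast
qed

lemma eigendirection_restriction_exists:
  assumes "jordan_chain (jacobian X (at 0)) q0 q1"
  shows "\<exists>R. eigendirection_restriction X q0 q1 R"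
proof -
  have "\<forall>u. \<exists>c. jacobian X (at 0) *v X (u *\<^sub>R q0) = c *\<^sub>R q0"
    using jordan_chain_range[OF assms] by blast
  then obtain R where "\<forall>u. jacobian X (at 0) *v X (u *\<^sub>R q0) = R u *\<^sub>R q0"
    by metis
  then show ?thesis
    unfolding eigendirection_restriction_def using assms by (intro exI[of _ R]) simp
qed

lemma eigendirection_restriction_unique:
  assumes "eigendirection_restriction X q0 q1 R" and "eigendirection_restriction X q0 q1 S"
  shows "\<forall>\<^sub>F u in nhds 0. R u = S u"
proof -
  have "\<forall>\<^sub>F u in nhds 0. jacobian X (at 0) *v X (u *\<^sub>R q0) = R u *\<^sub>R q0"
    and "\<forall>\<^sub>F u in nhds 0. jacobian X (at 0) *v X (u *\<^sub>R q0) = S u *\<^sub>R q0"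
    and "q0 \<noteq> 0"
    using assms by (auto simp: eigendirection_restriction_def jordan_chain_def)
  then show ?thesis
    by (auto elim: eventually_elim2)
qed

end

theory Submission
  imports Defs
begin

text \<open>
  The equation that defines the restriction associated with a chain \<open>(q\<^sub>0, q\<^sub>1)\<close> mentions \<open>q\<^sub>0\<close> only.
  Along the kernel line of \<open>A\<close>, the parameter \<open>u\<close> of \<open>a q\<^sub>0\<close> and the parameter \<open>a u\<close> of \<open>q\<^sub>0\<close> name the same
  point, so the value of \<open>A X\<close> there can be written both as \<open>R' u (a q\<^sub>0)\<close> and as \<open>R (a u) q\<^sub>0\<close>;
  comparing coefficients of the nonzero vector \<open>q\<^sub>0\<close> gives the transformation law. The second
  vector of the chain never enters, which is the independence of \<open>b\<close>.
\<close>

text \<open>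
  The second chain vectors \<open>q1\<close> and \<open>p1\<close> are unrelated here, so that one statement gives both the
  transformation law and its independence of the choice of the second vector.
\<close>

lemma eigendirection_restriction_rescale:
  assumes R: "eigendirection_restriction X q0 q1 R"
    and S: "eigendirection_restriction X (a *\<^sub>R q0) p1 S"
    and a: "a \<noteq> 0"
  shows "\<forall>\<^sub>F u in nhds 0. S u = 1 / a * R (a * u)"
proof -
  let ?A = "jacobian X (at 0)"
  have q0: "q0 \<noteq> 0"
    using R by (simp add: eigendirection_restriction_def jordan_chain_def)
  have R_ev: "\<forall>\<^sub>F v in nhds 0. ?A *v X (v *\<^sub>R q0) = R v *\<^sub>R q0"
    and S_ev: "\<forall>\<^sub>F u in nhds 0. ?A *v X (u *\<^sub>R (a *\<^sub>R q0)) = S u *\<^sub>R (a *\<^sub>R q0)"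
    using R S by (simp_all only: eigendirection_restriction_def)
  have "((\<lambda>u. a * u) \<longlongrightarrow> a * 0) (nhds 0)"
    by (intro tendsto_intros filterlim_ident)
  then have "filterlim (\<lambda>u. a * u) (nhds 0) (nhds 0)"
    by simp
  from eventually_compose_filterlim[OF R_ev this] S_ev show ?thesis
  proof eventually_elim
    case (elim u)
    have "(S u * a) *\<^sub>R q0 = R (a * u) *\<^sub>R q0"
      using elim by (auto simp: mult.commute)
    then have "S u * a = R (a * u)"
      using q0 by simp
    then show "S u = 1 / a * R (a * u)"
      using a by (simp add: field_simps)
  qed
qed

theorem theorem3p2:
  fixes X :: "real^2 \<Rightarrow> real^2" and r :: enat and A :: "real^2^2"
    and q0 q1 q0' q1' :: "real^2" and a b :: real and R R' :: "real \<Rightarrow> real"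
  assumes "r \<ge> 2" and "Cr_near_0 r X"
    and "X 0 = 0"
    and "A = jacobian X (at 0)" and "A \<noteq> 0" and "A ** A = 0"
    and "jordan_chain A q0 q1" and "jordan_chain A q0' q1'"
    and "a \<noteq> 0"
    and "q0' = a *\<^sub>R q0" and "q1' = a *\<^sub>R q1 + b *\<^sub>R q0"
    and "eigendirection_restriction X q0 q1 R"
    and "eigendirection_restriction X q0' q1' R'"
  shows "(\<forall>\<^sub>F u in nhds 0. R' u = 1 / a * R (a * u)) \<and>
    (\<forall>b2 R2. eigendirection_restriction X (a *\<^sub>R q0) (a *\<^sub>R q1 + b2 *\<^sub>R q0) R2
      \<longrightarrow> (\<forall>\<^sub>F u in nhds 0. R2 u = R' u))"
proof -
  have law: "\<forall>\<^sub>F u in nhds 0. S u = 1 / a * R (a * u)"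
    if "eigendirection_restriction X (a *\<^sub>R q0) p1 S" for p1 S
    using eigendirection_restriction_rescale assms that by blast
  have "eigendirection_restriction X (a *\<^sub>R q0) q1' R'"
    using assms by simp
  then have law': "\<forall>\<^sub>F u in nhds 0. R' u = 1 / a * R (a * u)"
    by (rule law)
  moreover have "\<forall>\<^sub>F u in nhds 0. R2 u = R' u"
    if "eigendirection_restriction X (a *\<^sub>R q0) (a *\<^sub>R q1 + b2 *\<^sub>R q0) R2" for b2 R2
    using law[OF that] law' by eventually_elim simp
  ultimately show ?thesis
    by blast
qed

end
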